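(* Let $M$ be a matroid with set of circuits $\mathcal{C}(M)$ and set of cocircuits $\mathcal{C}^*(M)$. Introduce variables $a_{e,X}$ for each pair $X\in\mathcal{C}(M)$, $e\in X$, and $b_{e,Y}$ for each pair $Y\in\mathcal{C}^*(M)$, $e\in Y$, and let $R$ be the polynomial ring over $F_2$ in these variables. Consider the system of polynomial equations in $R$ consisting of: for every $X\in\mathcal{C}(M)$, $Y\in\mathcal{C}^*(M)$ with $X\cap Y=\{e,f\}$ (two distinct elements), $$a_{e,X}+b_{e,Y}+a_{f,X}+b_{f,Y}+1=0,$$ and for every $X\in\mathcal{C}(M)$, $Y\in\mathcal{C}^*(M)$ with $X\cap Y=\{e,f,g\}$ (three distinct elements), $$1+a_{e,X}+b_{e,Y}+a_{f,X}+b_{f,Y}+a_{g,X}+b_{g,Y}+a_{e,X}a_{f,X}+a_{e,X}a_{g,X}+a_{e,X}b_{f,Y}+a_{e,X}b_{g,Y}+a_{f,X}a_{g,X}$$ $$+a_{f,X}b_{e,Y}+a_{f,X}b_{g,Y}+a_{g,X}b_{e,Y}+a_{g,X}b_{f,Y}+b_{e,Y}b_{f,Y}+b_{e,Y}b_{g,Y}+b_{f,Y}b_{g,Y}=0.$$ Then $M$ is orientable if and only if this system has a solution over $F_2$.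
   Context: With $\Sigma=\{0,+,-\}$ (multiplied and compared with $0$ as signs), a $\Sigma$-mapping for a matroid $M$ is a pair of maps $\phi_\Sigma:E(M)\times\mathcal{C}(M)\to\Sigma$, $\phi^*_\Sigma:E(M)\times\mathcal{C}^*(M)\to\Sigma$ with $\phi_\Sigma(e,X)=0$ iff $e\notin X$ and $\phi^*_\Sigma(e,Y)=0$ iff $e\notin Y$. The matroid $M$ is orientable if it has a $\Sigma$-mapping such that for every $X\in\mathcal{C}(M)$, $Y\in\mathcal{C}^*(M)$ with $|X\cap Y|\in\{2,3\}$: $\phi_\Sigma(e,X)\phi^*_\Sigma(e,Y)>0$ for some $e\in X\cap Y$ if and only if $\phi_\Sigma(f,X)\phi^*_\Sigma(f,Y)<0$ for some $f\in X\cap Y$. *)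

theory Defs
  imports "HOL-Library.FuncSet" "HOL-Library.Poly_Mapping" "HOL-Library.Z2"
begin

locale matroid =
  fixes E :: "'a set" and indep :: "'a set \<Rightarrow> bool"
  assumes finite_ground: "finite E"
    and indep_subset_ground: "indep X \<Longrightarrow> X \<subseteq> E"
    and indep_empty: "indep {}"
    and indep_subset: "indep X \<Longrightarrow> Y \<subseteq> X \<Longrightarrow> indep Y"
    and indep_augment:
      "indep X \<Longrightarrow> indep Y \<Longrightarrow> card X < card Y \<Longrightarrow> \<exists>y \<in> Y - X. indep (insert y X)"

definition basis :: "'a set \<Rightarrow> ('a set \<Rightarrow> bool) \<Rightarrow> 'a set \<Rightarrow> bool" where
  "basis E indep B \<longleftrightarrow> B \<subseteq> E \<and> indep B \<and> (\<forall>X. B \<subset> X \<and> X \<subseteq> E \<longrightarrow> \<not> indep X)"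

definition circuits :: "'a set \<Rightarrow> ('a set \<Rightarrow> bool) \<Rightarrow> 'a set set" where
  "circuits E indep = {X. X \<subseteq> E \<and> \<not> indep X \<and> (\<forall>Y. Y \<subset> X \<longrightarrow> indep Y)}"

text \<open>The bases of the dual matroid are the complements of the bases.\<close>

definition dual_indep :: "'a set \<Rightarrow> ('a set \<Rightarrow> bool) \<Rightarrow> 'a set \<Rightarrow> bool" where
  "dual_indep E indep X \<longleftrightarrow> (\<exists>B. basis E indep B \<and> X \<subseteq> E - B)"

definition cocircuits :: "'a set \<Rightarrow> ('a set \<Rightarrow> bool) \<Rightarrow> 'a set set" where
  "cocircuits E indep = circuits E (dual_indep E indep)"

text \<open>The signs \<open>0, +, -\<close> are the integers \<open>0, 1, -1\<close>, with their product and order.\<close>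

definition signs :: "int set" where
  "signs = {0, 1, -1}"

definition sign_mapping ::
  "'a set \<Rightarrow> ('a set \<Rightarrow> bool) \<Rightarrow> ('a \<Rightarrow> 'a set \<Rightarrow> int) \<Rightarrow> ('a \<Rightarrow> 'a set \<Rightarrow> int) \<Rightarrow> bool" where
  "sign_mapping E indep \<phi> \<psi> \<longleftrightarrow>
    (\<forall>e \<in> E. \<forall>X \<in> circuits E indep. \<phi> e X \<in> signs \<and> (\<phi> e X = 0 \<longleftrightarrow> e \<notin> X)) \<and>
    (\<forall>e \<in> E. \<forall>Y \<in> cocircuits E indep. \<psi> e Y \<in> signs \<and> (\<psi> e Y = 0 \<longleftrightarrow> e \<notin> Y))"

definition orientable :: "'a set \<Rightarrow> ('a set \<Rightarrow> bool) \<Rightarrow> bool" where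
  "orientable E indep \<longleftrightarrow>
    (\<exists>\<phi> \<psi>. sign_mapping E indep \<phi> \<psi> \<and>
      (\<forall>X \<in> circuits E indep. \<forall>Y \<in> cocircuits E indep. card (X \<inter> Y) \<in> {2, 3} \<longrightarrow>
        ((\<exists>e \<in> X \<inter> Y. \<phi> e X * \<psi> e Y > 0) \<longleftrightarrow> (\<exists>f \<in> X \<inter> Y. \<phi> f X * \<psi> f Y < 0))))"

text \<open>
  Polynomials with coefficients in \<open>'c\<close> and variables in \<open>'v\<close>: a monomial is its finitely
  supported exponent function, a polynomial its finitely supported coefficient function; the
  ring structure on \<open>\<Rightarrow>\<^sub>0\<close> is convolution.
\<close>

type_synonym ('v, 'c) mpoly = "('v \<Rightarrow>\<^sub>0 nat) \<Rightarrow>\<^sub>0 'c"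

definition Var :: "'v \<Rightarrow> ('v, 'c::comm_ring_1) mpoly" where
  "Var x = Poly_Mapping.single (Poly_Mapping.single x 1) 1"

definition poly_vars :: "('v, 'c::zero) mpoly \<Rightarrow> 'v set" where
  "poly_vars p = (\<Union>m \<in> Poly_Mapping.keys p. Poly_Mapping.keys m)"

definition poly_ring :: "'v set \<Rightarrow> ('v, 'c::zero) mpoly set" where
  "poly_ring V = {p. poly_vars p \<subseteq> V}"

definition eval_mpoly :: "('v \<Rightarrow> 'c) \<Rightarrow> ('v, 'c::comm_ring_1) mpoly \<Rightarrow> 'c" where
  "eval_mpoly v p =
    (\<Sum>m \<in> Poly_Mapping.keys p. Poly_Mapping.lookup p m *
      (\<Prod>x \<in> Poly_Mapping.keys m. v x ^ Poly_Mapping.lookup m x))"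

text \<open>The points of affine space with coordinates \<open>V\<close> are the functions defined exactly on \<open>V\<close>.\<close>

definition has_solution :: "'v set \<Rightarrow> ('v, 'c::comm_ring_1) mpoly set \<Rightarrow> bool" where
  "has_solution V S \<longleftrightarrow> (\<exists>v \<in> V \<rightarrow>\<^sub>E UNIV. \<forall>p \<in> S. eval_mpoly v p = 0)"

text \<open>\<open>VarA e X\<close> and \<open>VarB e Y\<close> are the indices of the variables $a_{e,X}$ and $b_{e,Y}$.\<close>

datatype 'a var = VarA 'a "'a set" | VarB 'a "'a set"

definition orientation_vars :: "'a set \<Rightarrow> ('a set \<Rightarrow> bool) \<Rightarrow> 'a var set" where
  "orientation_vars E indep =
    {VarA e X | e X. X \<in> circuits E indep \<and> e \<in> X} \<union>
    {VarB e Y | e Y. Y \<in> cocircuits E indep \<and> e \<in> Y}"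

definition two_poly :: "'a set \<Rightarrow> 'a set \<Rightarrow> 'a \<Rightarrow> 'a \<Rightarrow> ('a var, bit) mpoly" where
  "two_poly X Y e f =
    (let a = (\<lambda>x. Var (VarA x X)); b = (\<lambda>x. Var (VarB x Y))
     in a e + b e + a f + b f + 1)"

definition three_poly :: "'a set \<Rightarrow> 'a set \<Rightarrow> 'a \<Rightarrow> 'a \<Rightarrow> 'a \<Rightarrow> ('a var, bit) mpoly" where
  "three_poly X Y e f g =
    (let a = (\<lambda>x. Var (VarA x X)); b = (\<lambda>x. Var (VarB x Y))
     in 1 + a e + b e + a f + b f + a g + b g
        + a e * a f + a e * a g + a e * b f + a e * b g + a f * a g
        + a f * b e + a f * b g + a g * b e + a g * b f
        + b e * b f + b e * b g + b f * b g)"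

definition orientation_system :: "'a set \<Rightarrow> ('a set \<Rightarrow> bool) \<Rightarrow> ('a var, bit) mpoly set" where
  "orientation_system E indep =
    {two_poly X Y e f | X Y e f.
      X \<in> circuits E indep \<and> Y \<in> cocircuits E indep \<and> e \<noteq> f \<and> X \<inter> Y = {e, f}} \<union>
    {three_poly X Y e f g | X Y e f g.
      X \<in> circuits E indep \<and> Y \<in> cocircuits E indep \<and> e \<noteq> f \<and> e \<noteq> g \<and> f \<noteq> g \<and>
      X \<inter> Y = {e, f, g}}"

lemma poly_ring_1: "(1 :: ('v, 'c::comm_ring_1) mpoly) \<in> poly_ring V"
  by (simp add: poly_ring_def poly_vars_def)

lemma poly_ring_Var: "x \<in> V \<Longrightarrow> (Var x :: ('v, 'c::comm_ring_1) mpoly) \<in> poly_ring V"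
  by (simp add: poly_ring_def poly_vars_def Var_def)

lemma poly_ring_add:
  fixes p q :: "('v, 'c::comm_ring_1) mpoly"
  shows "p \<in> poly_ring V \<Longrightarrow> q \<in> poly_ring V \<Longrightarrow> p + q \<in> poly_ring V"
  unfolding poly_ring_def poly_vars_def using keys_add[of p q] by blast

lemma poly_ring_mult:
  fixes p q :: "('v, 'c::comm_ring_1) mpoly"
  assumes "p \<in> poly_ring V" "q \<in> poly_ring V"
  shows "p * q \<in> poly_ring V"
proof -
  have "x \<in> V" if m: "m \<in> Poly_Mapping.keys (p * q)" and x: "x \<in> Poly_Mapping.keys m" for m x
  proof -
    obtain s t where "m = s + t" "s \<in> Poly_Mapping.keys p" "t \<in> Poly_Mapping.keys q"
      using m keys_mult[of p q] by blast
    then show ?thesis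
      using x assms keys_add[of s t] unfolding poly_ring_def poly_vars_def by blast
  qed
  then show ?thesis
    unfolding poly_ring_def poly_vars_def by blast
qed

lemma orientation_system_subset:
  "orientation_system E indep \<subseteq> poly_ring (orientation_vars E indep)"
proof -
  have a: "Var (VarA x X) \<in> poly_ring (orientation_vars E indep)"
    if "X \<in> circuits E indep" "x \<in> X" for x X
    using that by (intro poly_ring_Var) (auto simp: orientation_vars_def)
  have b: "Var (VarB x Y) \<in> poly_ring (orientation_vars E indep)"
    if "Y \<in> cocircuits E indep" "x \<in> Y" for x Y
    using that by (intro poly_ring_Var) (auto simp: orientation_vars_def)
  show ?thesis
    unfolding orientation_system_def two_poly_def three_poly_def Let_def
    apply clarify
    apply (elim UnE CollectE exE conjE; hypsubst)
     apply (intro poly_ring_add poly_ring_mult poly_ring_1 a b; blast)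
    apply (intro poly_ring_add poly_ring_mult poly_ring_1 a b; blast)
    done
qed

lemma eval_mpoly_1: "eval_mpoly v (1 :: ('v, 'c::comm_ring_1) mpoly) = 1"
  by (simp add: eval_mpoly_def)

lemma eval_mpoly_Var: "eval_mpoly v (Var x :: ('v, 'c::comm_ring_1) mpoly) = v x"
  by (simp add: eval_mpoly_def Var_def)

lemma eval_mpoly_add:
  fixes p q :: "('v, 'c::comm_ring_1) mpoly"
  shows "eval_mpoly v (p + q) = eval_mpoly v p + eval_mpoly v q"
  unfolding eval_mpoly_def
  by (rule setsum_keys_plus_distrib) (simp_all add: distrib_right)

lemma eval_mpoly_Var_mult:
  "eval_mpoly v (Var x * Var y :: ('v, 'c::comm_ring_1) mpoly) = v x * v y"
proof (cases "x = y")
  case True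
  then show ?thesis
    by (simp add: eval_mpoly_def Var_def mult_single single_add[symmetric] power2_eq_square)
next
  case False
  let ?m = "Poly_Mapping.single x 1 + Poly_Mapping.single y (1::nat)"
  have "Poly_Mapping.keys ?m = {x, y}"
    using False by (auto simp: in_keys_iff lookup_add lookup_single when_def split: if_splits)
  then show ?thesis
    using False by (simp add: eval_mpoly_def Var_def mult_single lookup_add lookup_single when_def)
qed

end

theory Submission
  imports Defs
begin

text \<open>
  Encode the sign \<open>+\<close> as \<open>0\<close> and the sign \<open>-\<close> as \<open>1\<close> in \<open>F\<^sub>2\<close>, so that products of signs become sums.
  With $t_x = a_{x,X} + b_{x,Y}$ and $S = X \<inter> Y$, both kinds of equations have the form
  $\prod_{x \<in> S} t_x + \prod_{x \<in> S} (1 + t_x) = 0$, as the terms of top degree cancel.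
  The two products vanish when some $t_x$ is \<open>0\<close> and when some $t_x$ is \<open>1\<close>, respectively, so that
  the equation says that both values occur on \<open>S\<close> or neither does.
\<close>

definition balanced_on :: "('a \<Rightarrow> bit) \<Rightarrow> 'a set \<Rightarrow> bool" where
  "balanced_on t S \<longleftrightarrow> ((\<exists>x \<in> S. t x = 0) \<longleftrightarrow> (\<exists>x \<in> S. t x = 1))"

lemma balanced_on_cong:
  "(\<And>x. x \<in> S \<Longrightarrow> t x = u x) \<Longrightarrow> balanced_on t S \<longleftrightarrow> balanced_on u S"
  by (simp add: balanced_on_def)

lemma bit_add_eq_0_iff: "a + b = 0 \<longleftrightarrow> (a = 0 \<longleftrightarrow> b = 0)" for a b :: bit
  by (cases a; cases b) simp_all

lemma balanced_on_iff_prod: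
  assumes "finite S"
  shows "balanced_on t S \<longleftrightarrow> (\<Prod>x\<in>S. t x) + (\<Prod>x\<in>S. 1 + t x) = 0"
proof -
  have "(\<Prod>x\<in>S. t x) = 0 \<longleftrightarrow> (\<exists>x \<in> S. t x = 0)"
    using assms by (rule prod_zero_iff)
  moreover have "(\<Prod>x\<in>S. 1 + t x) = 0 \<longleftrightarrow> (\<exists>x \<in> S. t x = 1)"
    using assms by (simp add: bit_add_eq_0_iff)
  ultimately show ?thesis
    by (simp only: balanced_on_def bit_add_eq_0_iff)
qed

lemma balanced_on_doubleton_iff:
  assumes "e \<noteq> f"
  shows "balanced_on t {e, f} \<longleftrightarrow> 1 + t e + t f = 0"
proof -
  have "s * s' + (1 + s) * (1 + s') = 1 + s + s'" for s s' :: bit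
    by (cases s; cases s') simp_all
  with assms show ?thesis
    by (simp add: balanced_on_iff_prod)
qed

lemma balanced_on_tripleton_iff:
  assumes "e \<noteq> f" "e \<noteq> g" "f \<noteq> g"
  shows "balanced_on t {e, f, g} \<longleftrightarrow>
    1 + t e + t f + t g + t e * t f + t e * t g + t f * t g = 0"
proof -
  have "s * (s' * s'') + (1 + s) * ((1 + s') * (1 + s'')) =
      1 + s + s' + s'' + s * s' + s * s'' + s' * s''" for s s' s'' :: bit
    by (cases s; cases s'; cases s'') simp_all
  with assms show ?thesis
    by (simp add: balanced_on_iff_prod)
qed

definition sign_bit :: "'a::linordered_idom \<Rightarrow> bit" where
  "sign_bit s = (if s < 0 then 1 else 0)"

definition bit_sign :: "bit \<Rightarrow> int" where
  "bit_sign b = (if b = 0 then 1 else -1)"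

lemma sign_bit_bit_sign [simp]: "sign_bit (bit_sign b) = b"
  by (cases b) (simp_all add: sign_bit_def bit_sign_def)

lemma sign_bit_mult:
  "s \<noteq> 0 \<Longrightarrow> t \<noteq> 0 \<Longrightarrow> sign_bit (s * t) = sign_bit s + sign_bit t"
  by (auto simp: sign_bit_def mult_less_0_iff)

lemma balanced_on_sign_bit_iff:
  assumes "\<And>x. x \<in> S \<Longrightarrow> s x \<noteq> 0"
  shows "balanced_on (\<lambda>x. sign_bit (s x)) S \<longleftrightarrow> ((\<exists>x \<in> S. s x > 0) \<longleftrightarrow> (\<exists>x \<in> S. s x < 0))"
proof -
  have "sign_bit (s x) = 0 \<longleftrightarrow> s x > 0" "sign_bit (s x) = 1 \<longleftrightarrow> s x < 0" if "x \<in> S" for x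
    using assms[OF that] by (auto simp: sign_bit_def)
  then show ?thesis
    by (simp add: balanced_on_def)
qed

definition bit_orientation ::
  "'a set \<Rightarrow> ('a set \<Rightarrow> bool) \<Rightarrow> ('a \<Rightarrow> 'a set \<Rightarrow> bit) \<Rightarrow> ('a \<Rightarrow> 'a set \<Rightarrow> bit) \<Rightarrow> bool" where
  "bit_orientation E indep a b \<longleftrightarrow>
    (\<forall>X \<in> circuits E indep. \<forall>Y \<in> cocircuits E indep. card (X \<inter> Y) \<in> {2, 3} \<longrightarrow>
      balanced_on (\<lambda>e. a e X + b e Y) (X \<inter> Y))"

lemma circuit_subset_ground: "X \<in> circuits E indep \<Longrightarrow> X \<subseteq> E"
  by (simp add: circuits_def)

lemma cocircuit_subset_ground: "Y \<in> cocircuits E indep \<Longrightarrow> Y \<subseteq> E"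
  unfolding cocircuits_def by (rule circuit_subset_ground)

lemma sign_mapping_nonzero:
  assumes "sign_mapping E indep \<phi> \<psi>"
  shows "X \<in> circuits E indep \<Longrightarrow> e \<in> X \<Longrightarrow> \<phi> e X \<noteq> 0"
    and "Y \<in> cocircuits E indep \<Longrightarrow> e \<in> Y \<Longrightarrow> \<psi> e Y \<noteq> 0"
  using assms circuit_subset_ground[of X E indep] cocircuit_subset_ground[of Y E indep]
  by (simp_all add: sign_mapping_def subset_iff)

lemma bit_orientation_sign_bit_iff:
  assumes "sign_mapping E indep \<phi> \<psi>"
  shows "bit_orientation E indep (\<lambda>e X. sign_bit (\<phi> e X)) (\<lambda>e Y. sign_bit (\<psi> e Y)) \<longleftrightarrow>
    (\<forall>X \<in> circuits E indep. \<forall>Y \<in> cocircuits E indep. card (X \<inter> Y) \<in> {2, 3} \<longrightarrow>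
      ((\<exists>e \<in> X \<inter> Y. \<phi> e X * \<psi> e Y > 0) \<longleftrightarrow> (\<exists>f \<in> X \<inter> Y. \<phi> f X * \<psi> f Y < 0)))"
proof -
  have "balanced_on (\<lambda>e. sign_bit (\<phi> e X) + sign_bit (\<psi> e Y)) (X \<inter> Y) \<longleftrightarrow>
      ((\<exists>e \<in> X \<inter> Y. \<phi> e X * \<psi> e Y > 0) \<longleftrightarrow> (\<exists>f \<in> X \<inter> Y. \<phi> f X * \<psi> f Y < 0))"
    if X: "X \<in> circuits E indep" and Y: "Y \<in> cocircuits E indep" for X Y
  proof -
    have nonzero: "\<phi> e X \<noteq> 0" "\<psi> e Y \<noteq> 0" if "e \<in> X \<inter> Y" for e
      using that sign_mapping_nonzero[OF assms] X Y by blast+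
    then have "balanced_on (\<lambda>e. sign_bit (\<phi> e X) + sign_bit (\<psi> e Y)) (X \<inter> Y) \<longleftrightarrow>
        balanced_on (\<lambda>e. sign_bit (\<phi> e X * \<psi> e Y)) (X \<inter> Y)"
      by (intro balanced_on_cong) (simp add: sign_bit_mult)
    also have "\<dots> \<longleftrightarrow>
        ((\<exists>e \<in> X \<inter> Y. \<phi> e X * \<psi> e Y > 0) \<longleftrightarrow> (\<exists>f \<in> X \<inter> Y. \<phi> f X * \<psi> f Y < 0))"
      using nonzero by (intro balanced_on_sign_bit_iff) simp
    finally show ?thesis .
  qed
  then show ?thesis
    by (simp add: bit_orientation_def)
qed

lemma orientable_iff_bit_orientation:
  "orientable E indep \<longleftrightarrow> (\<exists>a b. bit_orientation E indep a b)"
proof -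
  have "orientable E indep \<longleftrightarrow> (\<exists>\<phi> \<psi>. sign_mapping E indep \<phi> \<psi> \<and>
      bit_orientation E indep (\<lambda>e X. sign_bit (\<phi> e X)) (\<lambda>e Y. sign_bit (\<psi> e Y)))"
    by (simp only: orientable_def bit_orientation_sign_bit_iff cong: conj_cong)
  also have "\<dots> \<longleftrightarrow> (\<exists>a b. bit_orientation E indep a b)"
  proof
    assume "\<exists>a b. bit_orientation E indep a b"
    then obtain a b where bits: "bit_orientation E indep a b"
      by blast
    define \<phi> where "\<phi> e X = (if e \<in> X then bit_sign (a e X) else 0)" for e X
    define \<psi> where "\<psi> e Y = (if e \<in> Y then bit_sign (b e Y) else 0)" for e Y
    have "sign_mapping E indep \<phi> \<psi>"
      by (simp add: sign_mapping_def \<phi>_def \<psi>_def bit_sign_def signs_def)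
    moreover have "balanced_on (\<lambda>e. sign_bit (\<phi> e X) + sign_bit (\<psi> e Y)) (X \<inter> Y) \<longleftrightarrow>
        balanced_on (\<lambda>e. a e X + b e Y) (X \<inter> Y)" for X Y
      by (rule balanced_on_cong) (simp add: \<phi>_def \<psi>_def)
    with bits have "bit_orientation E indep (\<lambda>e X. sign_bit (\<phi> e X)) (\<lambda>e Y. sign_bit (\<psi> e Y))"
      by (simp add: bit_orientation_def)
    ultimately show "\<exists>\<phi> \<psi>. sign_mapping E indep \<phi> \<psi> \<and>
        bit_orientation E indep (\<lambda>e X. sign_bit (\<phi> e X)) (\<lambda>e Y. sign_bit (\<psi> e Y))"
      by blast
  qed blast
  finally show ?thesis .
qed

lemma eval_mpoly_cong:
  assumes "\<And>x. x \<in> poly_vars p \<Longrightarrow> v x = w x"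
  shows "eval_mpoly v p = eval_mpoly w p"
  unfolding eval_mpoly_def using assms
  by (intro sum.cong prod.cong arg_cong2[where f = "(*)"] arg_cong2[where f = "(^)"] refl)
    (auto simp: poly_vars_def)

lemma has_solution_iff_total:
  fixes S :: "('v, 'c::comm_ring_1) mpoly set"
  assumes "S \<subseteq> poly_ring V"
  shows "has_solution V S \<longleftrightarrow> (\<exists>v. \<forall>p \<in> S. eval_mpoly v p = 0)"
proof
  assume "has_solution V S"
  then show "\<exists>v. \<forall>p \<in> S. eval_mpoly v p = 0"
    unfolding has_solution_def by blast
next
  assume "\<exists>v. \<forall>p \<in> S. eval_mpoly v p = 0"
  then obtain v :: "'v \<Rightarrow> 'c" where v: "\<forall>p \<in> S. eval_mpoly v p = 0"
    by blast
  have "eval_mpoly (restrict v V) p = eval_mpoly v p" if "p \<in> S" for p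
    using assms that by (intro eval_mpoly_cong) (auto simp: poly_ring_def)
  with v have "\<forall>p \<in> S. eval_mpoly (restrict v V) p = 0"
    by simp
  moreover have "restrict v V \<in> V \<rightarrow>\<^sub>E UNIV"
    by simp
  ultimately show "has_solution V S"
    unfolding has_solution_def by blast
qed

text \<open>The full simpset would rewrite sums and products of bits to \<open>XOR\<close> and \<open>AND\<close>, hence \<open>simp only\<close>.\<close>

lemma eval_two_poly_eq_0_iff:
  assumes "e \<noteq> f"
  shows "eval_mpoly v (two_poly X Y e f) = 0 \<longleftrightarrow>
    balanced_on (\<lambda>x. v (VarA x X) + v (VarB x Y)) {e, f}"
proof -
  define t where "t x = v (VarA x X) + v (VarB x Y)" for x
  have "eval_mpoly v (two_poly X Y e f) = 1 + t e + t f"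
    by (simp only: two_poly_def t_def Let_def eval_mpoly_add eval_mpoly_1 eval_mpoly_Var ac_simps)
  then have "eval_mpoly v (two_poly X Y e f) = 0 \<longleftrightarrow> balanced_on t {e, f}"
    by (simp only: balanced_on_doubleton_iff[OF assms])
  then show ?thesis
    by (simp only: t_def[abs_def])
qed

lemma eval_three_poly_eq_0_iff:
  assumes "e \<noteq> f" "e \<noteq> g" "f \<noteq> g"
  shows "eval_mpoly v (three_poly X Y e f g) = 0 \<longleftrightarrow>
    balanced_on (\<lambda>x. v (VarA x X) + v (VarB x Y)) {e, f, g}"
proof -
  define t where "t x = v (VarA x X) + v (VarB x Y)" for x
  have "eval_mpoly v (three_poly X Y e f g) =
      1 + t e + t f + t g + t e * t f + t e * t g + t f * t g"
    by (simp only: three_poly_def t_def Let_def eval_mpoly_add eval_mpoly_1 eval_mpoly_Var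
        eval_mpoly_Var_mult distrib_left distrib_right ac_simps)
  then have "eval_mpoly v (three_poly X Y e f g) = 0 \<longleftrightarrow> balanced_on t {e, f, g}"
    by (simp only: balanced_on_tripleton_iff[OF assms])
  then show ?thesis
    by (simp only: t_def[abs_def])
qed

lemma ball_orientation_system_iff:
  "(\<forall>p \<in> orientation_system E indep. P p) \<longleftrightarrow>
    (\<forall>X \<in> circuits E indep. \<forall>Y \<in> cocircuits E indep.
      (\<forall>e f. e \<noteq> f \<and> X \<inter> Y = {e, f} \<longrightarrow> P (two_poly X Y e f)) \<and>
      (\<forall>e f g. e \<noteq> f \<and> e \<noteq> g \<and> f \<noteq> g \<and> X \<inter> Y = {e, f, g} \<longrightarrow> P (three_poly X Y e f g)))"
  (is "_ \<longleftrightarrow> ?R")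
proof
  assume all_P: "\<forall>p \<in> orientation_system E indep. P p"
  have "two_poly X Y e f \<in> orientation_system E indep"
    if "X \<in> circuits E indep" "Y \<in> cocircuits E indep" "e \<noteq> f" "X \<inter> Y = {e, f}" for X Y e f
    using that unfolding orientation_system_def by blast
  moreover have "three_poly X Y e f g \<in> orientation_system E indep"
    if "X \<in> circuits E indep" "Y \<in> cocircuits E indep" "e \<noteq> f" "e \<noteq> g" "f \<noteq> g"
      "X \<inter> Y = {e, f, g}" for X Y e f g
    using that unfolding orientation_system_def by blast
  ultimately show ?R
    using all_P by simp
next
  assume ?R
  then show "\<forall>p \<in> orientation_system E indep. P p"
    by (auto simp: orientation_system_def)
qed

lemma card_2_or_3_imp_iff_all:
  "(card S \<in> {2, 3} \<longrightarrow> Q S) \<longleftrightarrow>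
    (\<forall>e f. e \<noteq> f \<and> S = {e, f} \<longrightarrow> Q {e, f}) \<and>
    (\<forall>e f g. e \<noteq> f \<and> e \<noteq> g \<and> f \<noteq> g \<and> S = {e, f, g} \<longrightarrow> Q {e, f, g})"
  unfolding insert_iff empty_iff card_2_iff card_3_iff by blast

lemma orientation_system_vanishes_iff:
  "(\<forall>p \<in> orientation_system E indep. eval_mpoly v p = 0) \<longleftrightarrow>
    bit_orientation E indep (\<lambda>e X. v (VarA e X)) (\<lambda>e Y. v (VarB e Y))"
  unfolding bit_orientation_def ball_orientation_system_iff card_2_or_3_imp_iff_all
  by (simp only: eval_two_poly_eq_0_iff eval_three_poly_eq_0_iff simp_thms cong: imp_cong)

lemma has_solution_iff_bit_orientation:
  "has_solution (orientation_vars E indep) (orientation_system E indep) \<longleftrightarrow>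
    (\<exists>a b. bit_orientation E indep a b)"
proof -
  have "has_solution (orientation_vars E indep) (orientation_system E indep) \<longleftrightarrow>
      (\<exists>v. bit_orientation E indep (\<lambda>e X. v (VarA e X)) (\<lambda>e Y. v (VarB e Y)))"
    by (simp add: has_solution_iff_total[OF orientation_system_subset]
        orientation_system_vanishes_iff)
  also have "\<dots> \<longleftrightarrow> (\<exists>a b. bit_orientation E indep a b)"
  proof
    assume "\<exists>a b. bit_orientation E indep a b"
    then obtain a b where "bit_orientation E indep a b"
      by blast
    then show "\<exists>v. bit_orientation E indep (\<lambda>e X. v (VarA e X)) (\<lambda>e Y. v (VarB e Y))"
      by (intro exI[of _ "case_var a b"]) simp
  qed blast
  finally show ?thesis .
qed

theorem theorem3p2:
  fixes E :: "'a set" and indep :: "'a set \<Rightarrow> bool"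
  assumes "matroid E indep"
  shows "orientable E indep \<longleftrightarrow>
    has_solution (orientation_vars E indep) (orientation_system E indep)"
  by (simp only: orientable_iff_bit_orientation has_solution_iff_bit_orientation)

end
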